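(* Let $n\ge 2$ be an integer and let $d=n-1$. Then the dual of the $(n,d)$ Delsarte linear program has a unique optimum if and only if $n$ is even, in which case the unique dual optimum is $c^*=(c_0^*,\dots,c_n^* )=\left(1,\frac{1}{n-1},0,0,\dots,0,\frac{1}{n-1}\right)$, i.e. $c_0^*=1$, $c_1^*=c_n^*=\frac{1}{n-1}$, and all other entries are $0$.
   Context: $[a,b]=\{x\in\mathbb{Z}: a\le x\le b\}$ and $[a]=\{1,\dots,a\}$. $\binom{a}{b}=0$ unless $0\le b\le a$. For $0\le i,j\le n$, the Krawtchouk polynomial is $K_j(i)=K_j(i;n)=\sum_{k=0}^j(-1)^k\binom{i}{k}\binom{n-i}{j-k}$. For integers $1\le d\le n$, the dual of the $(n,d)$ Delsarte linear program is the following linear program in real variables $c=(c_0,\dots,c_n)$: minimize $\sum_{j=0}^n c_j\binom{n}{j}$ subject to $\sum_{j=0}^n c_jK_j(i)\le 0$ for all $i\in[d,n]$; $c_j\ge 0$ for all $j\in[n]$; $c_0=1$. An optimum is a feasible point achieving the optimal objective value. *)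

theory Defs
  imports Complex_Main "Jordan_Normal_Form.Matrix"
begin

definition krawtchouk :: "nat \<Rightarrow> nat \<Rightarrow> nat \<Rightarrow> real" where
  "krawtchouk n j i =
     (\<Sum>k=0..j. (-1) ^ k * real (i choose k) * real ((n - i) choose (j - k)))"

text \<open>
  The variables \<open>(c\<^sub>0, \<dots>, c\<^sub>n)\<close> form a vector of dimension \<open>n + 1\<close>, so entries are
  indexed from 0. The constraints use \<open>krawtchouk n j i\<close> for \<open>i, j \<le> n\<close> only, where the natural
  number subtractions do not truncate.
\<close>

definition delsarte_dual_feasible :: "nat \<Rightarrow> nat \<Rightarrow> real vec \<Rightarrow> bool" where
  "delsarte_dual_feasible n d c \<longleftrightarrow>
     c \<in> carrier_vec (n + 1) \<and>
     (\<forall>i\<in>{d..n}. (\<Sum>j=0..n. c $ j * krawtchouk n j i) \<le> 0) \<and>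
     (\<forall>j\<in>{1..n}. 0 \<le> c $ j) \<and>
     c $ 0 = 1"

definition delsarte_dual_objective :: "nat \<Rightarrow> real vec \<Rightarrow> real" where
  "delsarte_dual_objective n c = (\<Sum>j=0..n. c $ j * real (n choose j))"

definition delsarte_dual_optimum :: "nat \<Rightarrow> nat \<Rightarrow> real vec \<Rightarrow> bool" where
  "delsarte_dual_optimum n d c \<longleftrightarrow>
     is_arg_min (delsarte_dual_objective n) (delsarte_dual_feasible n d) c"

end

theory Submission
  imports Defs
begin

text \<open>
  For \<open>d = n - 1\<close> only the two constraints at \<open>i = n\<close> and \<open>i = n - 1\<close> remain. Put
  \<open>x\<^sub>j = c\<^sub>j (n choose j)\<close>. The Krawtchouk values are
  \<open>K\<^sub>j(n) = (-1)\<^sup>j (n choose j)\<close> and \<open>K\<^sub>j(n-1) = (-1)\<^sup>j (n choose j) (n - 2j) / n\<close>, so the program is to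
  minimise \<open>\<Sum>\<^sub>j x\<^sub>j\<close> subject to \<open>A = \<Sum>\<^sub>j (-1)\<^sup>j x\<^sub>j \<le> 0\<close> and
  \<open>B = \<Sum>\<^sub>j (-1)\<^sup>j x\<^sub>j (n - 2j) / n \<le> 0\<close>, with \<open>x\<^sub>0 = 1\<close> and the other \<open>x\<^sub>j\<close> nonnegative.

  Everything follows from linear programming duality with two explicit multipliers
  \<open>p, q \<ge> 0\<close>, for \<open>A\<close> and \<open>B\<close> respectively
  (lemma \<open>objective_eq_reduced_cost_sum\<close>). Adding \<open>p A + q B\<close> to the objective gives \<open>x\<^sub>j\<close> the
  reduced cost \<open>w\<^sub>j = 1 + (-1)\<^sup>j (p + q (n - 2j) / n)\<close>. If \<open>w\<^sub>j \<ge> 0\<close> for all \<open>j \<ge> 1\<close>, then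
  \<open>w\<^sub>0 = 1 + p + q\<close> is a lower bound for the objective.

  For even \<open>n\<close> the choice \<open>p = 1/(n-1)\<close>, \<open>q = n/(n-1)\<close> makes \<open>w\<^sub>j\<close> equal to \<open>2(n-j)/(n-1)\<close> for even
  \<open>j\<close> and to \<open>2(j-1)/(n-1)\<close> for odd \<open>j\<close>. These vanish only at \<open>j = n\<close> and at \<open>j = 1\<close>, and both
  multipliers are positive. Complementary slackness therefore confines an optimum to the support
  \<open>{0, 1, n}\<close> and makes both constraints tight, which leaves two independent linear equations for
  \<open>c\<^sub>1\<close> and \<open>c\<^sub>n\<close>.

  For odd \<open>n\<close> the index \<open>n\<close> has the wrong sign, and the largest even index \<open>n - 1\<close> takes its place.
  Now the multipliers are \<open>p = 0\<close>, \<open>q = n/(n-2)\<close>. The constraint \<open>A \<le> 0\<close> is not priced, so it need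
  not be tight, and the optima form a segment; its two ends are exhibited.
\<close>

section \<open>Krawtchouk values at the two constrained points\<close>

lemma krawtchouk_at_n:
  "krawtchouk n j n = (-1) ^ j * real (n choose j)"
proof -
  have "krawtchouk n j n =
      (\<Sum>k\<in>{0..j}. if k = j then (-1) ^ j * real (n choose j) else 0)"
    unfolding krawtchouk_def by (rule sum.cong) (auto simp: binomial_eq_0)
  then show ?thesis by simp
qed

text \<open>The value is the coefficient of \<open>z\<^sup>j\<close> in \<open>(1 - z)\<^bsup>n-1\<^esup> (1 + z)\<close>, so only the last two terms of
  the defining sum survive. Pascal's rule and the absorption identity combine them into a multiple
  of \<open>n choose j\<close>.\<close>

lemma krawtchouk_at_pred_n:
  assumes "n \<ge> 1"
  shows "krawtchouk n j (n - 1) = (-1) ^ j * real (n choose j) * ((real n - 2 * real j) / real n)"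
proof (cases j)
  case 0
  then show ?thesis using assms by (simp add: krawtchouk_def)
next
  case (Suc i)
  obtain m where m: "n = Suc m" using assms by (cases n) auto
  have "krawtchouk n j (n - 1) =
     (\<Sum>k=0..Suc i. (-1) ^ k * real (m choose k) * real (1 choose (Suc i - k)))"
    by (simp add: krawtchouk_def m Suc)
  also have "\<dots> = (\<Sum>k=0..i. (-1) ^ k * real (m choose k) * real (1 choose (Suc i - k)))
      + (-1) ^ Suc i * real (m choose Suc i)"
    by simp
  also have "(\<Sum>k=0..i. (-1) ^ k * real (m choose k) * real (1 choose (Suc i - k)))
      = (\<Sum>k=0..i. if k = i then (-1) ^ i * real (m choose i) else 0)"
    by (rule sum.cong) (auto simp: binomial_eq_0)
  also have "\<dots> = (-1) ^ i * real (m choose i)" by simp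
  finally have K: "krawtchouk n j (n - 1) =
      (-1) ^ j * (real (m choose Suc i) - real (m choose i))"
    by (simp add: Suc algebra_simps)
  have absorb: "real (Suc i) * real (Suc m choose Suc i) = real (Suc m) * real (m choose i)"
    by (metis Suc_times_binomial_eq of_nat_mult mult.commute)
  have pascal: "real (Suc m choose Suc i) = real (m choose i) + real (m choose Suc i)"
    by simp
  have "real (Suc m) * (real (m choose Suc i) - real (m choose i)) =
      real (Suc m choose Suc i) * (real (Suc m) - 2 * real (Suc i))"
    using absorb pascal by (simp only: algebra_simps)
  then have "real (m choose Suc i) - real (m choose i) =
      real (n choose j) * ((real n - 2 * real j) / real n)"
    unfolding m Suc by (simp add: eq_divide_eq mult.commute del: of_nat_Suc binomial_Suc_Suc)
  then show ?thesis unfolding K by (simp add: mult.assoc)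
qed

text \<open>The two constraint forms are written in terms of the entries weighted by \<open>n choose j\<close>, in which
  the objective is the plain sum.\<close>

definition constraint_n :: "nat \<Rightarrow> real vec \<Rightarrow> real" where
  "constraint_n n c = (\<Sum>j=0..n. (-1) ^ j * (c $ j * real (n choose j)))"

definition constraint_pred_n :: "nat \<Rightarrow> real vec \<Rightarrow> real" where
  "constraint_pred_n n c =
     (\<Sum>j=0..n. (-1) ^ j * ((real n - 2 * real j) / real n) * (c $ j * real (n choose j)))"

lemma feasible_iff_two_constraints:
  assumes "n \<ge> 1"
  shows "delsarte_dual_feasible n (n - 1) c \<longleftrightarrow>
    c \<in> carrier_vec (n + 1) \<and> constraint_n n c \<le> 0 \<and> constraint_pred_n n c \<le> 0 \<and>
    (\<forall>j\<in>{1..n}. 0 \<le> c $ j) \<and> c $ 0 = 1"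
proof -
  have "{n - 1..n} = {n - 1, n}" using assms by auto
  moreover have "(\<Sum>j=0..n. c $ j * krawtchouk n j n) = constraint_n n c"
    unfolding constraint_n_def krawtchouk_at_n by (simp add: algebra_simps)
  moreover have "(\<Sum>j=0..n. c $ j * krawtchouk n j (n - 1)) = constraint_pred_n n c"
    unfolding constraint_pred_n_def krawtchouk_at_pred_n[OF assms]
    by (simp add: ac_simps)
  ultimately show ?thesis
    unfolding delsarte_dual_feasible_def by auto
qed

section \<open>Weak duality\<close>

text \<open>The multiplier \<open>p\<close> prices the constraint at \<open>n\<close> and \<open>q\<close> the one at \<open>n - 1\<close>.\<close>

definition reduced_cost :: "nat \<Rightarrow> real \<Rightarrow> real \<Rightarrow> nat \<Rightarrow> real" where
  "reduced_cost n p q j = 1 + (-1) ^ j * (p + q * ((real n - 2 * real j) / real n))"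

lemma objective_eq_reduced_cost_sum:
  assumes "n \<ge> 1" and "c $ 0 = 1"
  shows "delsarte_dual_objective n c =
    (1 + p + q) + (\<Sum>j=1..n. reduced_cost n p q j * (c $ j * real (n choose j)))
      - p * constraint_n n c - q * constraint_pred_n n c"
proof -
  have "delsarte_dual_objective n c + p * constraint_n n c + q * constraint_pred_n n c
     = (\<Sum>j=0..n. reduced_cost n p q j * (c $ j * real (n choose j)))"
    unfolding delsarte_dual_objective_def constraint_n_def constraint_pred_n_def
      sum_distrib_left sum.distrib[symmetric]
    by (rule sum.cong) (simp_all add: reduced_cost_def distrib_left distrib_right mult.assoc mult.left_commute)
  also have "\<dots> = reduced_cost n p q 0 * (c $ 0 * real (n choose 0))
      + (\<Sum>j=1..n. reduced_cost n p q j * (c $ j * real (n choose j)))"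
    by (simp add: sum.atLeast_Suc_atMost)
  finally show ?thesis using assms by (simp add: reduced_cost_def algebra_simps)
qed

lemma reduced_cost_sum_nonneg:
  assumes "n \<ge> 1" and "delsarte_dual_feasible n (n - 1) c"
    and "\<And>j. j \<in> {1..n} \<Longrightarrow> reduced_cost n p q j \<ge> 0"
  shows "(\<Sum>j=1..n. reduced_cost n p q j * (c $ j * real (n choose j))) \<ge> 0"
  using iffD1[OF feasible_iff_two_constraints[OF assms(1)] assms(2)] assms(3)
  by (intro sum_nonneg mult_nonneg_nonneg) auto

lemma objective_lower_bound:
  assumes "n \<ge> 1" and "delsarte_dual_feasible n (n - 1) c" and "p \<ge> 0" and "q \<ge> 0"
    and "\<And>j. j \<in> {1..n} \<Longrightarrow> reduced_cost n p q j \<ge> 0"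
  shows "1 + p + q \<le> delsarte_dual_objective n c"
proof -
  have c: "c $ 0 = 1" "constraint_n n c \<le> 0" "constraint_pred_n n c \<le> 0"
    using iffD1[OF feasible_iff_two_constraints[OF assms(1)] assms(2)] by auto
  have "p * constraint_n n c \<le> 0" "q * constraint_pred_n n c \<le> 0"
    using c assms(3,4) by (auto simp: mult_nonneg_nonpos)
  with reduced_cost_sum_nonneg[OF assms(1,2,5)] show ?thesis
    using objective_eq_reduced_cost_sum[where c = c and p = p and q = q, OF assms(1) c(1)] by linarith
qed

text \<open>At the bound the gap is a sum of nonnegative terms that adds up to zero, so each of them
  vanishes.\<close>

lemma complementary_slackness:
  assumes "n \<ge> 1" and "delsarte_dual_feasible n (n - 1) c" and "p > 0" and "q > 0"
    and nonneg: "\<And>j. j \<in> {1..n} \<Longrightarrow> reduced_cost n p q j \<ge> 0"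
    and "delsarte_dual_objective n c = 1 + p + q"
  shows "constraint_n n c = 0" and "constraint_pred_n n c = 0"
    and "\<And>j. j \<in> {1..n} \<Longrightarrow> reduced_cost n p q j > 0 \<Longrightarrow> c $ j = 0"
proof -
  let ?S = "\<Sum>j=1..n. reduced_cost n p q j * (c $ j * real (n choose j))"
  have c: "c $ 0 = 1" "constraint_n n c \<le> 0" "constraint_pred_n n c \<le> 0"
      "\<And>j. j \<in> {1..n} \<Longrightarrow> c $ j \<ge> 0"
    using iffD1[OF feasible_iff_two_constraints[OF assms(1)] assms(2)] by auto
  have le: "p * constraint_n n c \<le> 0" "q * constraint_pred_n n c \<le> 0"
    using c assms(3,4) by (auto simp: mult_nonneg_nonpos)
  have eq: "?S - p * constraint_n n c - q * constraint_pred_n n c = 0"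
    using objective_eq_reduced_cost_sum[where c = c and p = p and q = q, OF assms(1) c(1)] assms(6) by linarith
  have S: "?S \<ge> 0" by (rule reduced_cost_sum_nonneg[OF assms(1,2) nonneg])
  have "p * constraint_n n c = 0" "q * constraint_pred_n n c = 0" and S0: "?S = 0"
    using eq le S by linarith+
  then show "constraint_n n c = 0" "constraint_pred_n n c = 0"
    using assms(3,4) by simp_all
  fix j assume j: "j \<in> {1..n}" and pos: "reduced_cost n p q j > 0"
  have "\<forall>j\<in>{1..n}. reduced_cost n p q j * (c $ j * real (n choose j)) = 0"
    using S0 by (subst (asm) sum_nonneg_eq_0_iff) (auto intro!: mult_nonneg_nonneg nonneg c(4))
  then have "reduced_cost n p q j * (c $ j * real (n choose j)) = 0" using j by blast
  then show "c $ j = 0" using j pos by auto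
qed

text \<open>Attainment of the lower bound \<open>v\<close> by some \<open>e\<close> identifies \<open>v\<close> as the optimal value, so optimality
  of any other vector becomes an equation.\<close>

lemma optimum_iff_attains_bound:
  assumes "\<And>c. delsarte_dual_feasible n d c \<Longrightarrow> v \<le> delsarte_dual_objective n c"
    and "delsarte_dual_feasible n d e" and "delsarte_dual_objective n e = v"
  shows "delsarte_dual_optimum n d c \<longleftrightarrow>
    delsarte_dual_feasible n d c \<and> delsarte_dual_objective n c = v"
  unfolding delsarte_dual_optimum_def is_arg_min_def
  using assms by (metis less_le_not_le linorder_not_less order_antisym_conv)

section \<open>Dual vectors supported on three indices\<close>

definition sparse_vec :: "nat \<Rightarrow> nat \<Rightarrow> real \<Rightarrow> real \<Rightarrow> real vec" where
  "sparse_vec n r a b =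
     vec (n + 1) (\<lambda>j. if j = 0 then 1 else if j = 1 then a else if j = r then b else 0)"

lemma sum_sparse_vec:
  assumes "1 < r" and "r \<le> n"
  shows "(\<Sum>j=0..n. f j * (sparse_vec n r a b $ j * g j)) =
    f 0 * g 0 + f 1 * (a * g 1) + f r * (b * (g r :: real))"
proof -
  have "(\<Sum>j=0..n. f j * (sparse_vec n r a b $ j * g j)) =
      (\<Sum>j\<in>{0, 1, r}. f j * (sparse_vec n r a b $ j * g j))"
    using assms by (intro sum.mono_neutral_right) (auto simp: sparse_vec_def)
  then show ?thesis using assms by (simp add: sparse_vec_def)
qed

lemma objective_sparse_vec:
  assumes "1 < r" and "r \<le> n"
  shows "delsarte_dual_objective n (sparse_vec n r a b) = 1 + a * real n + b * real (n choose r)"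
  using sum_sparse_vec[OF assms, of "\<lambda>_. 1" a b "\<lambda>j. real (n choose j)"]
  by (simp add: delsarte_dual_objective_def)

lemma constraint_n_sparse_vec:
  assumes "1 < r" and "r \<le> n"
  shows "constraint_n n (sparse_vec n r a b) =
    1 - a * real n + (-1) ^ r * (b * real (n choose r))"
  using sum_sparse_vec[OF assms, of "\<lambda>j. (-1) ^ j" a b "\<lambda>j. real (n choose j)"]
  by (simp add: constraint_n_def)

lemma constraint_pred_n_sparse_vec:
  assumes "1 < r" and "r \<le> n"
  shows "constraint_pred_n n (sparse_vec n r a b) =
    1 - a * (real n - 2) + (-1) ^ r * ((real n - 2 * real r) / real n) * (b * real (n choose r))"
  using sum_sparse_vec[OF assms, of "\<lambda>j. (-1) ^ j * ((real n - 2 * real j) / real n)" a b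
      "\<lambda>j. real (n choose j)"] assms
  by (simp add: constraint_pred_n_def minus_mult_left mult.commute[of a])

lemma feasible_sparse_vec:
  assumes "1 < r" and "r \<le> n" and "a \<ge> 0" and "b \<ge> 0"
    and "constraint_n n (sparse_vec n r a b) \<le> 0"
    and "constraint_pred_n n (sparse_vec n r a b) \<le> 0"
  shows "delsarte_dual_feasible n (n - 1) (sparse_vec n r a b)"
  using assms by (subst feasible_iff_two_constraints) (auto simp: sparse_vec_def)

section \<open>Even length\<close>

text \<open>For even \<open>n\<close>, these multipliers are the solution of \<open>w\<^sub>1 = w\<^sub>n = 0\<close>.\<close>

lemma reduced_cost_even:
  assumes "n \<ge> 2"
  shows "reduced_cost n (1 / (real n - 1)) (real n / (real n - 1)) j =
    (if even j then 2 * (real n - real j) / (real n - 1) else 2 * (real j - 1) / (real n - 1))"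
proof -
  have "real n / (real n - 1) * ((real n - 2 * real j) / real n) = (real n - 2 * real j) / (real n - 1)"
    using assms by simp
  moreover have "real n - 1 \<noteq> 0" using assms by auto
  ultimately show ?thesis by (simp add: reduced_cost_def divide_simps)
qed

lemma optimum_iff_even:
  assumes n: "n \<ge> 2" and "even n"
  shows "delsarte_dual_optimum n (n - 1) c \<longleftrightarrow>
    c = sparse_vec n n (1 / (real n - 1)) (1 / (real n - 1))"
proof -
  define p where "p = 1 / (real n - 1)"
  define q where "q = real n / (real n - 1)"
  let ?e = "sparse_vec n n p p"
  have n1: "n \<ge> 1" "1 < n" and pq: "p > 0" "q > 0" using n by (auto simp: p_def q_def)
  have w: "reduced_cost n p q j =
      (if even j then 2 * (real n - real j) / (real n - 1) else 2 * (real j - 1) / (real n - 1))" for j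
    unfolding p_def q_def by (rule reduced_cost_even[OF n])
  have w_nonneg: "reduced_cost n p q j \<ge> 0" if "j \<in> {1..n}" for j
    using that n by (auto simp: w)
  have w_pos: "reduced_cost n p q j > 0" if "j \<in> {1..n}" "j \<noteq> 1" "j \<noteq> n" for j
    using that n by (auto simp: w intro!: divide_pos_pos)
  have bound: "1 + p + q \<le> delsarte_dual_objective n c"
    if "delsarte_dual_feasible n (n - 1) c" for c
    using objective_lower_bound[OF n1(1) that, of p q] pq w_nonneg by simp
  have A: "constraint_n n (sparse_vec n n a b) = 1 - a * real n + b" for a b
    using constraint_n_sparse_vec[of n n a b] n1 \<open>even n\<close> by simp
  have B: "constraint_pred_n n (sparse_vec n n a b) = 1 - a * (real n - 2) - b" for a b
    using constraint_pred_n_sparse_vec[of n n a b] n1 \<open>even n\<close> by (simp add: field_simps)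
  have e_feas: "delsarte_dual_feasible n (n - 1) ?e"
    using n pq by (intro feasible_sparse_vec) (auto simp: A B p_def field_simps)
  have e_obj: "delsarte_dual_objective n ?e = 1 + p + q"
    using objective_sparse_vec[of n n p p] n by (simp add: p_def q_def)
  have unique: "c = ?e"
    if feas: "delsarte_dual_feasible n (n - 1) c" and obj: "delsarte_dual_objective n c = 1 + p + q"
    for c
  proof -
    note slack = complementary_slackness[OF n1(1) feas pq w_nonneg obj]
    have c: "dim_vec c = n + 1" "c $ 0 = 1"
      using iffD1[OF feasible_iff_two_constraints[OF n1(1)] feas] by auto
    have zero: "c $ j = 0" if "j \<in> {1..n}" "j \<noteq> 1" "j \<noteq> n" for j
      using slack(3)[OF _ that(1)] w_pos[OF that] by blast
    have c_eq: "c = sparse_vec n n (c $ 1) (c $ n)"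
      by (rule eq_vecI) (use c zero in \<open>auto simp: sparse_vec_def\<close>)
    have "1 - c $ 1 * real n + c $ n = 0"
      using slack(1) A[of "c $ 1" "c $ n"] c_eq by simp
    moreover have "1 - c $ 1 * (real n - 2) - c $ n = 0"
      using slack(2) B[of "c $ 1" "c $ n"] c_eq by simp
    ultimately have "c $ 1 * (real n - 1) = 1" and cn: "c $ n = c $ 1 * real n - 1"
      by (simp_all add: algebra_simps)
    then have "c $ 1 = p" using n by (simp add: p_def field_simps)
    moreover have "c $ n = p"
      using cn \<open>c $ 1 = p\<close> n by (simp add: p_def field_simps)
    ultimately show ?thesis using c_eq by simp
  qed
  have "delsarte_dual_optimum n (n - 1) c \<longleftrightarrow> c = ?e"
    using optimum_iff_attains_bound[OF bound e_feas e_obj] unique e_feas e_obj by blast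
  then show ?thesis unfolding p_def .
qed

section \<open>Odd length\<close>

text \<open>For odd \<open>n\<close>, solving \<open>w\<^sub>1 = w\<^bsub>n-1\<^esub> = 0\<close> gives \<open>p = 0\<close>, which is where uniqueness gets lost.\<close>

lemma reduced_cost_odd:
  assumes "n \<ge> 3"
  shows "reduced_cost n 0 (real n / (real n - 2)) j =
    (if even j then 2 * (real n - 1 - real j) / (real n - 2) else 2 * (real j - 1) / (real n - 2))"
proof -
  have "real n / (real n - 2) * ((real n - 2 * real j) / real n) = (real n - 2 * real j) / (real n - 2)"
    using assms by simp
  moreover have "real n - 2 \<noteq> 0" "n \<noteq> 0" using assms by auto
  ultimately show ?thesis by (simp add: reduced_cost_def divide_simps)
qed

text \<open>With \<open>p = 0\<close>, a nonnegative vector with \<open>c\<^sub>0 = 1\<close> supported on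
  \<open>{0, 1, n - 1}\<close> is optimal as soon as the constraint at \<open>n - 1\<close> is tight, which reads \<open>c\<^sub>1 + c\<^bsub>n-1\<^esub> = 1/(n-2)\<close>, and the constraint at \<open>n\<close> holds, which reads
  \<open>c\<^sub>1 - c\<^bsub>n-1\<^esub> \<ge> 1/n\<close>. One witness below has \<open>c\<^bsub>n-1\<^esub> = 0\<close>; the other makes the second
  condition an equality.\<close>

lemma two_optima_odd:
  assumes n: "n \<ge> 3" and "odd n"
  shows "\<exists>c c'. delsarte_dual_optimum n (n - 1) c \<and> delsarte_dual_optimum n (n - 1) c' \<and> c \<noteq> c'"
proof -
  define q where "q = real n / (real n - 2)"
  have q: "q \<ge> 0" and r: "1 < n - 1" "n - 1 \<le> n" and n1: "n \<ge> 1" using n by (auto simp: q_def)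
  have n_choose: "real (n choose (n - 1)) = real n"
    using n by (metis binomial_symmetric[of 1 n] choose_one n1)
  have w_nonneg: "reduced_cost n 0 q j \<ge> 0" if "j \<in> {1..n}" for j
  proof (cases "even j")
    case True
    \<comment> \<open>parity excludes \<open>j = n\<close>, where the formula for even \<open>j\<close> would be negative\<close>
    then have "j \<noteq> n" using \<open>odd n\<close> by auto
    then have "real j \<le> real n - 1" using that by auto
    then show ?thesis using True n reduced_cost_odd[OF n, of j] by (simp add: q_def)
  next
    case False
    then show ?thesis using that n reduced_cost_odd[OF n, of j] by (simp add: q_def)
  qed
  have bound: "1 + q \<le> delsarte_dual_objective n c"
    if "delsarte_dual_feasible n (n - 1) c" for c
    using objective_lower_bound[OF n1 that, of 0 q] q w_nonneg by simp
  have A: "constraint_n n (sparse_vec n (n - 1) a b) = 1 - a * real n + b * real n" for a b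
    using constraint_n_sparse_vec[OF r, of a b] \<open>odd n\<close> n_choose by simp
  have B: "constraint_pred_n n (sparse_vec n (n - 1) a b) =
      1 - a * (real n - 2) - b * (real n - 2)" for a b
  proof -
    have "real n - 2 * real (n - 1) = - (real n - 2)" using n by (simp add: of_nat_diff)
    moreover have "x / real n * (b * real n) = b * x" for x using n by simp
    ultimately have "(real n - 2 * real (n - 1)) / real n * (b * real n) = - (b * (real n - 2))"
      by (simp only: mult_minus_right)
    then show ?thesis
      using constraint_pred_n_sparse_vec[OF r, of a b] \<open>odd n\<close> n_choose by simp
  qed
  have opt: "delsarte_dual_optimum n (n - 1) (sparse_vec n (n - 1) a b)"
    if "a \<ge> 0" "b \<ge> 0" "a + b = 1 / (real n - 2)" "1 / real n \<le> a - b" for a b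
  proof -
    have B0: "(a + b) * (real n - 2) = 1" using that(3) n by simp
    have A0: "1 \<le> (a - b) * real n" using that(4) n by (simp add: field_simps)
    have "constraint_n n (sparse_vec n (n - 1) a b) \<le> 0"
      unfolding A using A0 by (simp add: algebra_simps)
    moreover have "constraint_pred_n n (sparse_vec n (n - 1) a b) \<le> 0"
      unfolding B using B0 by (simp add: algebra_simps)
    ultimately have feas: "delsarte_dual_feasible n (n - 1) (sparse_vec n (n - 1) a b)"
      using that(1,2) r by (intro feasible_sparse_vec)
    have "delsarte_dual_objective n (sparse_vec n (n - 1) a b) = 1 + (a + b) * real n"
      using objective_sparse_vec[OF r, of a b] n_choose by (simp add: algebra_simps)
    also have "\<dots> = 1 + q" by (simp add: that(3) q_def)
    finally show ?thesis using optimum_iff_attains_bound[OF bound feas] feas by blast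
  qed
  let ?c = "sparse_vec n (n - 1) (1 / (real n - 2)) 0"
  let ?b = "1 / (real n * (real n - 2))"
  let ?c' = "sparse_vec n (n - 1) ((real n - 1) * ?b) ?b"
  have "delsarte_dual_optimum n (n - 1) ?c"
    using n by (intro opt) (auto simp: field_simps)
  moreover have "delsarte_dual_optimum n (n - 1) ?c'"
  proof (rule opt)
    have "(real n - 1) * ?b + ?b = real n * ?b" by (simp only: algebra_simps)
    then show "(real n - 1) * ?b + ?b = 1 / (real n - 2)" using n by simp
    have "(real n - 1) * ?b - ?b = (real n - 2) * ?b" by (simp only: algebra_simps)
    then show "1 / real n \<le> (real n - 1) * ?b - ?b" using n by simp
  qed (use n in auto)
  moreover have "?c $ (n - 1) \<noteq> ?c' $ (n - 1)"
    using n r by (auto simp: sparse_vec_def)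
  then have "?c \<noteq> ?c'" by metis
  ultimately show ?thesis by blast
qed

theorem theorem3p5:
  fixes n d :: nat
  assumes "n \<ge> 2" and "d = n - 1"
  shows "((\<exists>!c. delsarte_dual_optimum n d c) \<longleftrightarrow> even n) \<and>
         (even n \<longrightarrow>
            (\<forall>c. delsarte_dual_optimum n d c \<longleftrightarrow>
                 c = vec (n + 1) (\<lambda>j. if j = 0 then 1
                                      else if j = 1 \<or> j = n then 1 / (real n - 1)
                                      else 0)))"
proof (cases "even n")
  case True
  have "sparse_vec n n (1 / (real n - 1)) (1 / (real n - 1)) =
      vec (n + 1) (\<lambda>j. if j = 0 then 1 else if j = 1 \<or> j = n then 1 / (real n - 1) else 0)"
    unfolding sparse_vec_def by (rule arg_cong[where f = "vec (n + 1)"]) auto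
  then show ?thesis using optimum_iff_even[OF assms(1) True] True assms(2) by auto
next
  case False
  then have "n \<ge> 3" using assms(1) by (cases "n = 2") auto
  then show ?thesis using two_optima_odd[OF _ False] False assms(2) by blast
qed

end
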